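(* Let $E$ be the equation $x+y=2z$. Then $E$ is $3$-rainbow-uncommon over both $[n]$ and $\mathbb{Z}_n$. In particular, as $n\to\infty$, $$\frac{2}{3}+o(1)\;\le\;\mathrm{rb}_{[n]}(x+y=2z),$$ $$\frac13-o(1)\;\le\;\mathrm{rb}_{\mathbb{Z}_n}(x+y=2z)\;\le\;\frac23\qquad\text{when } n \text{ is not a multiple of } 3,$$ $$\mathrm{rb}_{\mathbb{Z}_n}(x+y=2z)=\frac23\qquad\text{when } n=3t \text{ for some } t\in\mathbb{N}.$$ The upper bound $\frac23$ in the second display and the equality in the third are exact (for every such $n$), while the $o(1)$ terms are functions of $n$ tending to $0$ as $n\to\infty$.
   Context: $[n]=\{1,2,\dots,n\}$ and $\mathbb{Z}_n$ denotes the integers modulo $n$. Let $X_n$ be either $[n]$ or $\mathbb{Z}_n$. A $3$-coloring of a set $X$ is a surjective function $f:X\to\{1,2,3\}$ (so $n\ge 3$ is understood, so that $3$-colorings of $X_n$ exist). For an equation $E$ of the form $ax+by=cz$ with $a,b,c$ positive integers, let $$T_{X_n}(E)=\{(x,y,z)\in X_n^3 : ax+by=cz\}$$ (the equation is read modulo $n$ when $X_n=\mathbb{Z}_n$; these are ordered triples, and $x,y,z$ need not be distinct). For a $3$-coloring $f$ of $X_n$, a triple $(x,y,z)\in T_{X_n}(E)$ is rainbow if $f(x)\ne f(y)$, $f(x)\ne f(z)$ and $f(y)\ne f(z)$. Let $\mathrm{Rb}_{f,X_n}(E)$ be the set of rainbow triples in $T_{X_n}(E)$, let $$\mathrm{rb}_{f,X_n}(E)=\frac{|\mathrm{Rb}_{f,X_n}(E)|}{|T_{X_n}(E)|},$$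 and let $\mathrm{rb}_{X_n}(E)$ be the maximum of $\mathrm{rb}_{f,X_n}(E)$ over all $3$-colorings $f$ of $X_n$. The equation $E$ is called $3$-rainbow-uncommon over $X_n$ if $\liminf_{n\to\infty}\mathrm{rb}_{X_n}(E)=\frac29+\Omega(1)$, meaning that this $\liminf$ is strictly greater than $\frac29$. *)

theory Defs
  imports
    Complex_Main
    "HOL-Library.FuncSet"
    "HOL-Library.Extended_Real"
    "HOL-Number_Theory.Cong"
begin

text \<open>
  The ambient family \<open>X\<^sub>n\<close> is either \<open>[n]\<close> (\<open>Interval\<close>) or \<open>\<int>\<^sub>n\<close> (\<open>Cyclic\<close>). The elements of
  \<open>\<int>\<^sub>n\<close> are represented by their least residues \<open>0, \<dots>, n - 1\<close>, and equations between them
  are read as congruences modulo \<open>n\<close>.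
\<close>

datatype ambient = Interval | Cyclic

fun ambient_set :: "ambient \<Rightarrow> nat \<Rightarrow> nat set" where
  "ambient_set Interval n = {1..n}"
| "ambient_set Cyclic n = {0..<n}"

fun ambient_eq :: "ambient \<Rightarrow> nat \<Rightarrow> nat \<Rightarrow> nat \<Rightarrow> bool" where
  "ambient_eq Interval n u v \<longleftrightarrow> u = v"
| "ambient_eq Cyclic n u v \<longleftrightarrow> [u = v] (mod n)"

text \<open>The parameters \<open>a\<close>, \<open>b\<close>, \<open>c\<close> below stand for the equation \<open>a x + b y = c z\<close>.\<close>

definition solutions :: "ambient \<Rightarrow> nat \<Rightarrow> nat \<Rightarrow> nat \<Rightarrow> nat \<Rightarrow> (nat \<times> nat \<times> nat) set" where
  "solutions X a b c n =
    {(x, y, z). x \<in> ambient_set X n \<and> y \<in> ambient_set X n \<and> z \<in> ambient_set X n \<and>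
                ambient_eq X n (a * x + b * y) (c * z)}"

definition three_colorings :: "'a set \<Rightarrow> ('a \<Rightarrow> nat) set" where
  "three_colorings S = {f \<in> S \<rightarrow>\<^sub>E {1, 2, 3}. f ` S = {1, 2, 3}}"

definition rainbow_solutions ::
    "ambient \<Rightarrow> nat \<Rightarrow> nat \<Rightarrow> nat \<Rightarrow> nat \<Rightarrow> (nat \<Rightarrow> nat) \<Rightarrow> (nat \<times> nat \<times> nat) set" where
  "rainbow_solutions X a b c n f =
    {(x, y, z) \<in> solutions X a b c n. f x \<noteq> f y \<and> f x \<noteq> f z \<and> f y \<noteq> f z}"

definition rb_coloring ::
    "ambient \<Rightarrow> nat \<Rightarrow> nat \<Rightarrow> nat \<Rightarrow> nat \<Rightarrow> (nat \<Rightarrow> nat) \<Rightarrow> real" where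
  "rb_coloring X a b c n f =
    real (card (rainbow_solutions X a b c n f)) / real (card (solutions X a b c n))"

text \<open>
  Three-colorings of \<open>X\<^sub>n\<close> exist only for \<open>n \<ge> 3\<close>; for smaller \<open>n\<close> the following maximum is over
  the empty set and its value is meaningless.
\<close>

definition rb :: "ambient \<Rightarrow> nat \<Rightarrow> nat \<Rightarrow> nat \<Rightarrow> nat \<Rightarrow> real" where
  "rb X a b c n = Max (rb_coloring X a b c n ` three_colorings (ambient_set X n))"

definition three_rainbow_uncommon :: "ambient \<Rightarrow> nat \<Rightarrow> nat \<Rightarrow> nat \<Rightarrow> bool" where
  "three_rainbow_uncommon X a b c \<longleftrightarrow> liminf (\<lambda>n. ereal (rb X a b c n)) > ereal (2 / 9)"

end

theory Submission
  imports Defs "HOL-Analysis.Convex"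
begin

text \<open>
  Colour every point by its residue modulo 3. As \<open>x + y = 2 z\<close> forces \<open>3 dvd x + y + z\<close>, a solution
  over the integers is rainbow as soon as two of its entries are incongruent modulo 3, so only the
  pairs \<open>x \<equiv> y (mod 6)\<close> (about one third of the pairs of equal parity) are lost.
  Integer solutions make up about half of the solutions in \<open>\<int>\<^sub>n\<close>, and all of them behave in this
  way if \<open>3 dvd n\<close>. Conversely a solution in \<open>\<int>\<^sub>n\<close> is determined by \<open>(y, z)\<close>, and by
  Cauchy--Schwarz at least one third of these pairs are monochromatic.
\<close>

section \<open>Counting pairs with equal colour or equal residue\<close>

text \<open>The monochromatic pairs split into squares of the colour classes, so Cauchy-Schwarz
  applies to the class sizes. With parity as the colour this bounds integer solutions from below;
  with a 3-coloring it yields the upper bound 2/3.\<close>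

lemma card_square_le_monochromatic_pairs:
  assumes "finite S" "finite C" "f ` S \<subseteq> C"
  shows "(card S)\<^sup>2 \<le> card C * card {(x, y) \<in> S \<times> S. f x = f y}"
proof -
  define F where "F c = {x \<in> S. f x = c}" for c
  have fin: "finite (F c)" for c
    using assms(1) by (simp add: F_def)
  have "S = (\<Union>c\<in>C. F c)"
    using assms(3) by (auto simp: F_def)
  then have S: "card S = (\<Sum>c\<in>C. card (F c))"
    using card_UN_disjoint[of C F] assms(2) fin by (auto simp: F_def)
  have "{(x, y) \<in> S \<times> S. f x = f y} = (\<Union>c\<in>C. F c \<times> F c)"
    using assms(3) by (auto simp: F_def)
  then have P: "card {(x, y) \<in> S \<times> S. f x = f y} = (\<Sum>c\<in>C. (card (F c))\<^sup>2)"
    using card_UN_disjoint[of C "\<lambda>c. F c \<times> F c"] assms(2) fin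
    by (auto simp: F_def card_cartesian_product power2_eq_square)
  have "(\<Sum>c\<in>C. real (card (F c)))\<^sup>2 \<le> (\<Sum>c\<in>C. (real (card (F c)))\<^sup>2) * real (card C)"
    by (rule sum_squared_le_sum_of_squares)
  then have "real ((card S)\<^sup>2) \<le> real (card C * card {(x, y) \<in> S \<times> S. f x = f y})"
    unfolding S P by (simp add: mult.commute)
  then show ?thesis
    unfolding of_nat_le_iff .
qed

text \<open>Cut the interval into blocks of length \<open>k\<close> starting at \<open>m\<close>: a
  block holds at most one member of a residue class, and there are n/k blocks, rounded up. The map
  \<open>(y - m) div k\<close> is the block index.\<close>

lemma card_residue_class_le:
  fixes k m n r :: nat
  assumes "k > 0"
  shows "card {y \<in> {m..<m + n}. y mod k = r} \<le> (n + k - 1) div k"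
proof -
  let ?A = "{y \<in> {m..<m + n}. y mod k = r}"
  have "inj_on (\<lambda>y. (y - m) div k) ?A"
  proof (rule inj_onI)
    fix y y' assume y: "y \<in> ?A" and y': "y' \<in> ?A" and eq: "(y - m) div k = (y' - m) div k"
    have "[(y - m) + m = (y' - m) + m] (mod k)"
      using y y' by (simp add: cong_def)
    then have "(y - m) mod k = (y' - m) mod k"
      by (simp only: cong_add_rcancel_nat) (simp only: cong_def)
    with eq have "y - m = y' - m"
      by (metis div_mult_mod_eq)
    then show "y = y'"
      using y y' by auto
  qed
  moreover have "(\<lambda>y. (y - m) div k) ` ?A \<subseteq> {..<(n + k - 1) div k}"
  proof (rule image_subsetI)
    fix y assume "y \<in> ?A"
    then have "m \<le> y" "y < m + n"
      by auto
    then have "(y - m) div k + 1 = (y - m + k) div k"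
      using assms by (intro div_add_self2[symmetric]) simp
    also have "\<dots> \<le> (n + k - 1) div k"
      using \<open>m \<le> y\<close> \<open>y < m + n\<close> by (intro div_le_mono) linarith
    finally show "(y - m) div k \<in> {..<(n + k - 1) div k}"
      by simp
  qed
  ultimately have "card ?A \<le> card {..<(n + k - 1) div k}"
    by (rule card_inj_on_le) simp
  then show ?thesis
    by (simp only: card_lessThan)
qed

lemma card_congruent_pairs_le:
  fixes k m n :: nat
  assumes "k > 0"
  shows "card {(x, y) \<in> {m..<m + n} \<times> {m..<m + n}. x mod k = y mod k} \<le> n * ((n + k - 1) div k)"
proof -
  have "{(x, y) \<in> {m..<m + n} \<times> {m..<m + n}. x mod k = y mod k}
      = (SIGMA x : {m..<m + n}. {y \<in> {m..<m + n}. y mod k = x mod k})"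
    by auto
  then have "card {(x, y) \<in> {m..<m + n} \<times> {m..<m + n}. x mod k = y mod k}
      = (\<Sum>x\<in>{m..<m + n}. card {y \<in> {m..<m + n}. y mod k = x mod k})"
    by simp
  also have "\<dots> \<le> (\<Sum>x\<in>{m..<m + n}. (n + k - 1) div k)"
    by (intro sum_mono card_residue_class_le assms)
  finally show ?thesis
    by simp
qed

text \<open>Rounding n/6 up costs at most 5/6. This loss is the source of the error terms of order
  1/n in both lower bounds below.\<close>

lemma card_congruent_mod_6_pairs_le:
  "6 * card {(x, y) \<in> {m..<m + n} \<times> {m..<m + n}. x mod 6 = y mod (6::nat)} \<le> n * (n + 5)"
proof -
  have "card {(x, y) \<in> {m..<m + n} \<times> {m..<m + n}. x mod 6 = y mod (6::nat)}
      \<le> n * ((n + 6 - 1) div 6)"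
    by (rule card_congruent_pairs_le) simp
  also have "n + 6 - 1 = n + 5"
    by simp
  finally have "6 * card {(x, y) \<in> {m..<m + n} \<times> {m..<m + n}. x mod 6 = y mod (6::nat)}
      \<le> n * (6 * ((n + 5) div 6))"
    by linarith
  also have "\<dots> \<le> n * (n + 5)"
    by (intro mult_left_mono) auto
  finally show ?thesis .
qed

lemma card_square_le_same_parity_pairs:
  "n\<^sup>2 \<le> 2 * card {(x, y) \<in> {m..<m + n} \<times> {m..<m + n}. x mod 2 = y mod (2::nat)}"
proof -
  have "(\<lambda>x. x mod 2) ` {m..<m + n} \<subseteq> {0, 1}"
    by auto
  from card_square_le_monochromatic_pairs[OF _ _ this] show ?thesis
    by (simp add: numeral_2_eq_2)
qed

section \<open>Solutions over the integers\<close>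

lemma sum_eq_double_iff:
  fixes x y z :: nat
  shows "x + y = 2 * z \<longleftrightarrow> x mod 2 = y mod 2 \<and> z = (x + y) div 2"
proof -
  have "x mod 2 = y mod 2 \<longleftrightarrow> even (x + y)"
    by (simp add: mod2_eq_if)
  then show ?thesis
    by (metis dvd_mult_div_cancel dvd_triv_left nonzero_mult_div_cancel_left zero_neq_numeral)
qed

text \<open>The part shared by both ambients: it is all of \<open>solutions\<close> for
  \<open>Interval\<close>, and a subset of it for \<open>Cyclic\<close>.\<close>

definition integer_solutions :: "nat set \<Rightarrow> (nat \<times> nat \<times> nat) set" where
  "integer_solutions S = {(x, y, z). x \<in> S \<and> y \<in> S \<and> z \<in> S \<and> x + y = 2 * z}"

text \<open>The third entry is the midpoint of the other two, and an interval contains the midpoint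
  of any two of its points of equal parity.\<close>

lemma card_integer_solutions:
  "card (integer_solutions {m..<m + n})
    = card {(x, y) \<in> {m..<m + n} \<times> {m..<m + n}. x mod 2 = y mod (2::nat)}"
proof -
  let ?P = "{(x, y) \<in> {m..<m + n} \<times> {m..<m + n}. x mod 2 = y mod (2::nat)}"
  have "integer_solutions {m..<m + n} = (\<lambda>(x, y). (x, y, (x + y) div 2)) ` ?P"
    unfolding integer_solutions_def sum_eq_double_iff by (auto simp: image_iff)
  moreover have "inj_on (\<lambda>(x, y). (x, y, (x + y) div 2)) ?P"
    by (auto simp: inj_on_def)
  ultimately show ?thesis
    by (simp add: card_image)
qed

lemma finite_integer_solutions: "finite S \<Longrightarrow> finite (integer_solutions S)"
  by (rule finite_subset[of _ "S \<times> S \<times> S"]) (auto simp: integer_solutions_def)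

text \<open>Three residues modulo 3 with sum zero are all equal or all distinct; the proof checks
  the 27 residue triples.\<close>

lemma distinct_mod_3:
  fixes x y z :: nat
  assumes "3 dvd x + y + z" "y mod 3 \<noteq> z mod 3"
  shows "x mod 3 \<noteq> y mod 3 \<and> x mod 3 \<noteq> z mod 3"
proof -
  have "(x mod 3 + y mod 3 + z mod 3) mod 3 = (x + y + z) mod 3"
    by (intro mod_add_cong mod_mod_trivial)
  then have "(x mod 3 + y mod 3 + z mod 3) mod 3 = 0"
    using assms(1) by simp
  moreover have "w mod 3 \<in> {0, 1, 2}" for w :: nat
    by auto
  from this[of x] this[of y] this[of z]
  have "x mod 3 \<in> {0, 1, 2}" "y mod 3 \<in> {0, 1, 2}" "z mod 3 \<in> {0, 1, 2}" .
  ultimately show ?thesis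
    using assms(2) by (elim insertE emptyE) simp_all
qed

text \<open>Since x + y + z = 3z, failing to be rainbow forces x and y to agree modulo 3. They also
  agree modulo 2, hence modulo 6, and (x, y) determines z.\<close>

lemma card_nonrainbow_integer_solutions_le:
  "6 * card {(x, y, z) \<in> integer_solutions {m..<m + n}.
      \<not> (x mod 3 \<noteq> y mod 3 \<and> x mod 3 \<noteq> z mod 3 \<and> y mod 3 \<noteq> z mod 3)} \<le> n * (n + 5)"
  (is "6 * card ?N \<le> _")
proof -
  let ?Q = "{(x, y) \<in> {m..<m + n} \<times> {m..<m + n}. x mod 6 = y mod (6::nat)}"
  have "x mod 6 = y mod 6"
    if "x + y = 2 * z" "\<not> (x mod 3 \<noteq> y mod 3 \<and> x mod 3 \<noteq> z mod 3 \<and> y mod 3 \<noteq> z mod 3)"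
    for x y z :: nat
  proof -
    have "z + x + y = 3 * z"
      using that(1) by simp
    then have "3 dvd z + x + y"
      by (simp only: dvd_triv_left)
    then have "x mod 3 = y mod 3"
      using that(2) distinct_mod_3[of z x y] by metis
    moreover have "x mod 2 = y mod 2"
      using that(1) by (simp add: sum_eq_double_iff)
    ultimately show ?thesis
      using coprime_cong_mult_nat[of x y 3 2] by (simp add: cong_def)
  qed
  then have "(\<lambda>(x, y, z). (x, y)) ` ?N \<subseteq> ?Q"
    by (auto simp: integer_solutions_def)
  moreover have "inj_on (\<lambda>(x, y, z). (x, y)) ?N"
    by (auto simp: inj_on_def integer_solutions_def)
  moreover have "finite ?Q"
    by (rule finite_subset[of _ "{m..<m + n} \<times> {m..<m + n}"]) auto
  ultimately have "card ?N \<le> card ?Q"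
    using card_inj_on_le by blast
  then show ?thesis
    using card_congruent_mod_6_pairs_le[of m n] by linarith
qed

section \<open>The residue colouring and the maximum over colourings\<close>

text \<open>The shift by 1 gives the colours 1, 2, 3; the restriction to \<open>S\<close> makes the
  function extensional, as \<open>three_colorings\<close> demands.\<close>

definition mod_3_coloring :: "nat set \<Rightarrow> nat \<Rightarrow> nat" where
  "mod_3_coloring S = (\<lambda>x\<in>S. x mod 3 + 1)"

lemma mod_3_coloring_in_three_colorings:
  assumes "n \<ge> 3"
  shows "mod_3_coloring {m..<m + n} \<in> three_colorings {m..<m + n}"
proof -
  have "\<exists>x\<in>{m..<m + n}. c = x mod 3 + 1" if "c \<in> {1, 2, 3}" for c
  proof -
    \<comment> \<open>The offset must be congruent to c - 1 - m; \<open>2 * m\<close> replaces -m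
      modulo 3 to avoid truncated subtraction. As \<open>i < 3\<close> and \<open>n \<ge> 3\<close>,
      the point \<open>m + i\<close> stays in the interval.\<close>
    define i where "i = (c - 1 + 2 * m) mod 3"
    have "(m + i) mod 3 = (c - 1 + m * 3) mod 3"
      unfolding i_def mod_add_right_eq by (simp add: ac_simps)
    also have "\<dots> = c - 1"
      using that by auto
    finally have "c = (m + i) mod 3 + 1"
      using that by auto
    moreover have "i < 3"
      by (simp add: i_def)
    ultimately show ?thesis
      using assms by (intro bexI[of _ "m + i"]) auto
  qed
  moreover have "x mod 3 + 1 \<in> {1, 2, 3}" for x :: nat
    by auto
  ultimately show ?thesis
    unfolding three_colorings_def mod_3_coloring_def by (auto simp: image_iff)
qed

text \<open>Brings both ambients into the shape \<open>{m..<m + n}\<close>, so that the interval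
  counts above serve for both.\<close>

lemma ambient_set_atLeastLessThan:
  "ambient_set Interval n = {1..<1 + n}" "ambient_set Cyclic n = {0..<0 + n}"
  by auto

lemma ambient_mod_3_coloring_in_three_colorings:
  "n \<ge> 3 \<Longrightarrow> mod_3_coloring (ambient_set X n) \<in> three_colorings (ambient_set X n)"
  by (cases X) (simp_all only: ambient_set_atLeastLessThan mod_3_coloring_in_three_colorings)

lemma finite_ambient_set: "finite (ambient_set X n)"
  by (cases X) auto

lemma finite_three_colorings: "finite S \<Longrightarrow> finite (three_colorings S)"
  unfolding three_colorings_def by (rule finite_subset[OF _ finite_PiE[of S "\<lambda>_. {1, 2, 3}"]]) auto

lemma rb_coloring_le_rb:
  "f \<in> three_colorings (ambient_set X n) \<Longrightarrow> rb_coloring X a b c n f \<le> rb X a b c n"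
  unfolding rb_def by (intro Max_ge finite_imageI finite_three_colorings finite_ambient_set) auto

text \<open>\<open>Max\<close> obeys this rule only on a nonempty finite set; for
  \<open>n \<ge> 3\<close> the residue colouring shows that a colouring exists.\<close>

lemma rb_le:
  assumes "n \<ge> 3" "\<And>f. f \<in> three_colorings (ambient_set X n) \<Longrightarrow> rb_coloring X a b c n f \<le> B"
  shows "rb X a b c n \<le> B"
  unfolding rb_def using ambient_mod_3_coloring_in_three_colorings[OF assms(1)] assms(2)
  by (subst Max_le_iff) (auto intro!: finite_three_colorings finite_ambient_set)

lemma finite_solutions: "finite (solutions X a b c n)"
  by (rule finite_subset[of _ "ambient_set X n \<times> ambient_set X n \<times> ambient_set X n"])
    (auto simp: solutions_def finite_ambient_set)

lemma finite_rainbow_solutions: "finite (rainbow_solutions X a b c n f)"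
  by (rule finite_subset[OF _ finite_solutions]) (auto simp: rainbow_solutions_def)

lemma rainbow_mod_3_coloring:
  "rainbow_solutions X a b c n (mod_3_coloring (ambient_set X n))
    = {(x, y, z) \<in> solutions X a b c n. x mod 3 \<noteq> y mod 3 \<and> x mod 3 \<noteq> z mod 3 \<and> y mod 3 \<noteq> z mod 3}"
  by (auto simp: rainbow_solutions_def mod_3_coloring_def solutions_def)

lemma card_rainbow_mod_3_ge:
  assumes S: "ambient_set X n = {m..<m + n}"
    and sub: "integer_solutions {m..<m + n} \<subseteq> solutions X a b c n"
  shows "card (integer_solutions {m..<m + n})
    \<le> card (rainbow_solutions X a b c n (mod_3_coloring (ambient_set X n))) + real n * (real n + 5) / 6"
proof -
  let ?I = "integer_solutions {m..<m + n}"
  let ?R = "rainbow_solutions X a b c n (mod_3_coloring (ambient_set X n))"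
  let ?N = "{(x, y, z) \<in> ?I.
      \<not> (x mod 3 \<noteq> y mod 3 \<and> x mod 3 \<noteq> z mod 3 \<and> y mod 3 \<noteq> z mod 3)}"
  have "?I \<subseteq> ?R \<union> ?N"
    using sub unfolding rainbow_mod_3_coloring by auto
  moreover have "finite ?R" "finite ?N"
    using finite_integer_solutions[of "{m..<m + n}"]
    by (auto simp: finite_rainbow_solutions elim!: rev_finite_subset)
  ultimately have "card ?I \<le> card ?R + card ?N"
    by (meson card_Un_le card_mono finite_UnI le_trans)
  moreover have "real (6 * card ?N) \<le> real (n * (n + 5))"
    unfolding of_nat_le_iff by (rule card_nonrainbow_integer_solutions_le)
  then have "6 * real (card ?N) \<le> real n * (real n + 5)"
    by (simp only: of_nat_mult of_nat_add of_nat_numeral)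
  ultimately show ?thesis
    by linarith
qed

section \<open>The lower bound over the interval\<close>

text \<open>The loss of at most n(n + 5)/6 solutions is compared with the total \<open>I\<close>: as
  n^2 is at most 2\<open>I\<close>, the lost fraction is at most 1/3 + 5/(3n).\<close>

lemma rb_Interval_ge:
  assumes "n \<ge> 3"
  shows "2 / 3 - 5 / (3 * real n) \<le> rb Interval 1 1 2 n"
proof -
  let ?f = "mod_3_coloring (ambient_set Interval n)"
  have T: "solutions Interval 1 1 2 n = integer_solutions {1..<1 + n}"
    by (auto simp: solutions_def integer_solutions_def)
  define I where "I = real (card (integer_solutions {1..<1 + n}))"
  define R where "R = real (card (rainbow_solutions Interval 1 1 2 n ?f))"
  have IR: "I \<le> R + real n * (real n + 5) / 6"
    unfolding I_def R_def by (intro card_rainbow_mod_3_ge ambient_set_atLeastLessThan)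
      (simp only: T order_refl)
  have "n\<^sup>2 \<le> 2 * card (integer_solutions {1..<1 + n})"
    unfolding card_integer_solutions by (rule card_square_le_same_parity_pairs)
  then have n2: "(real n)\<^sup>2 \<le> 2 * I"
    unfolding I_def by (metis of_nat_le_iff of_nat_mult of_nat_numeral of_nat_power)
  have pos: "real n > 0" "I > 0"
    using assms n2 zero_less_power[of "real n" 2] by linarith+
  have "real n * (real n + 5) / 6 = (real n + 5) / (6 * real n) * (real n)\<^sup>2"
    using pos by (simp add: field_simps power2_eq_square)
  also have "\<dots> \<le> (real n + 5) / (6 * real n) * (2 * I)"
    using n2 by (intro mult_left_mono) auto
  also have "\<dots> = (1 / 3 + 5 / (3 * real n)) * I"
    using pos by (simp add: field_simps)
  finally have "I - (1 / 3 + 5 / (3 * real n)) * I \<le> R"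
    using IR by linarith
  also have "I - (1 / 3 + 5 / (3 * real n)) * I = (2 / 3 - 5 / (3 * real n)) * I"
    by (simp add: algebra_simps)
  finally have "(2 / 3 - 5 / (3 * real n)) * I \<le> R" .
  with pos(2) have "2 / 3 - 5 / (3 * real n) \<le> rb_coloring Interval 1 1 2 n ?f"
    unfolding rb_coloring_def T I_def[symmetric] R_def[symmetric]
    by (simp add: pos_le_divide_eq)
  also have "\<dots> \<le> rb Interval 1 1 2 n"
    by (intro rb_coloring_le_rb ambient_mod_3_coloring_in_three_colorings assms)
  finally show ?thesis .
qed

section \<open>Bounds over the integers modulo n\<close>

text \<open>The coefficient of x is 1, so x = 2z - y is the unique solution for every modulus.
  Projecting to (x, y) would fail for even \<open>n\<close>, where 2 is not invertible.\<close>

lemma bij_betw_solutions_Cyclic: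
  "bij_betw snd (solutions Cyclic 1 1 2 n) ({0..<n} \<times> {0..<n})"
proof (rule bij_betwI')
  fix s t assume s: "s \<in> solutions Cyclic 1 1 2 n" and t: "t \<in> solutions Cyclic 1 1 2 n"
  show "snd s = snd t \<longleftrightarrow> s = t"
  proof
    assume "snd s = snd t"
    moreover obtain x y z where xyz: "s = (x, y, z)"
      by (cases s)
    ultimately obtain x' where x': "t = (x', y, z)"
      by (cases t) auto
    have "[x + y = 2 * z] (mod n)" "[x' + y = 2 * z] (mod n)"
      using s t unfolding xyz x' solutions_def by simp_all
    then have "[x + y = x' + y] (mod n)"
      using cong_sym cong_trans by blast
    then have "[x = x'] (mod n)"
      by (simp add: cong_add_rcancel_nat)
    then show "s = t"
      using s t unfolding xyz x' solutions_def by (simp add: cong_less_modulus_unique_nat)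
  qed simp
next
  fix s assume "s \<in> solutions Cyclic 1 1 2 n"
  then show "snd s \<in> {0..<n} \<times> {0..<n}"
    by (auto simp: solutions_def)
next
  fix p assume "p \<in> {0..<n} \<times> {0..<n}"
  then obtain y z where p: "p = (y, z)" "y < n" "z < n"
    by auto
  \<comment> \<open>Here \<open>n - y\<close> plays the role of -y; it is not truncated because
    \<open>y < n\<close>.\<close>
  have "[(2 * z + (n - y)) mod n + y = 2 * z + (n - y) + y] (mod n)"
    by (simp add: cong_def mod_add_left_eq)
  also have "2 * z + (n - y) + y = 2 * z + n"
    using p by simp
  also have "[2 * z + n = 2 * z] (mod n)"
    by (simp add: cong_def)
  finally have "((2 * z + (n - y)) mod n, y, z) \<in> solutions Cyclic 1 1 2 n"
    using p by (simp add: solutions_def)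
  then show "\<exists>s\<in>solutions Cyclic 1 1 2 n. p = snd s"
    using p by force
qed

lemma card_solutions_Cyclic: "card (solutions Cyclic 1 1 2 n) = n\<^sup>2"
  using bij_betw_same_card[OF bij_betw_solutions_Cyclic[of n]]
  by (simp add: card_cartesian_product power2_eq_square)

text \<open>Integer solutions alone suffice: at least n^2/2 of the n^2 solutions are of this kind
  and at most n(n + 5)/6 of them are lost, leaving 1/2 - 1/6 = 1/3 up to the rounding term.\<close>

lemma rb_Cyclic_ge:
  assumes "n \<ge> 3"
  shows "1 / 3 - 5 / (6 * real n) \<le> rb Cyclic 1 1 2 n"
proof -
  let ?f = "mod_3_coloring (ambient_set Cyclic n)"
  define I where "I = real (card (integer_solutions {0..<0 + n}))"
  define R where "R = real (card (rainbow_solutions Cyclic 1 1 2 n ?f))"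
  have IR: "I \<le> R + real n * (real n + 5) / 6"
    unfolding I_def R_def
    by (intro card_rainbow_mod_3_ge ambient_set_atLeastLessThan)
      (auto simp: solutions_def integer_solutions_def)
  have "n\<^sup>2 \<le> 2 * card (integer_solutions {0..<0 + n})"
    unfolding card_integer_solutions by (rule card_square_le_same_parity_pairs)
  then have "(real n)\<^sup>2 \<le> 2 * I"
    unfolding I_def by (metis of_nat_le_iff of_nat_mult of_nat_numeral of_nat_power)
  then have "(real n)\<^sup>2 / 3 - 5 * real n / 6 \<le> R"
    using IR by (simp add: power2_eq_square algebra_simps add_divide_distrib)
  then have "1 / 3 - 5 / (6 * real n) \<le> rb_coloring Cyclic 1 1 2 n ?f"
    using assms unfolding rb_coloring_def card_solutions_Cyclic R_def[symmetric]
    by (simp add: pos_le_divide_eq left_diff_distrib power2_eq_square)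
  also have "\<dots> \<le> rb Cyclic 1 1 2 n"
    by (intro rb_coloring_le_rb ambient_mod_3_coloring_in_three_colorings assms)
  finally show ?thesis .
qed

lemma rb_Cyclic_le:
  assumes "n \<ge> 3"
  shows "rb Cyclic 1 1 2 n \<le> 2 / 3"
proof (rule rb_le[OF assms])
  fix f assume f: "f \<in> three_colorings (ambient_set Cyclic n)"
  let ?S = "{0..<n}"
  let ?R = "rainbow_solutions Cyclic 1 1 2 n f"
  let ?M = "{(y, z) \<in> ?S \<times> ?S. f y = f z}"
  have R: "?R \<subseteq> solutions Cyclic 1 1 2 n"
    by (auto simp: rainbow_solutions_def)
  have finM: "finite ?M"
    by (rule finite_subset[of _ "?S \<times> ?S"]) auto
  have card_R: "card ?R = card (snd ` ?R)"
    using card_image[OF inj_on_subset[OF bij_betw_imp_inj_on[OF bij_betw_solutions_Cyclic] R]] by simp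
  \<comment> \<open>A rainbow solution has y and z of different colours, so its pair (y, z) avoids
    the monochromatic pairs, which make up at least a third of all pairs.\<close>
  have "card (snd ` ?R) + card ?M = card (snd ` ?R \<union> ?M)"
    using finM R finite_rainbow_solutions
    by (intro card_Un_disjoint[symmetric]) (auto simp: rainbow_solutions_def)
  also have "\<dots> \<le> card (?S \<times> ?S)"
  proof (intro card_mono Un_least)
    show "snd ` ?R \<subseteq> ?S \<times> ?S"
      using image_mono[OF R, of snd] bij_betw_imp_surj_on[OF bij_betw_solutions_Cyclic[of n]]
      by (simp only:)
  qed auto
  also have "card (?S \<times> ?S) = n\<^sup>2"
    by (simp add: card_cartesian_product power2_eq_square)
  finally have "card ?R + card ?M \<le> n\<^sup>2"
    unfolding card_R .
  moreover have "n\<^sup>2 \<le> 3 * card ?M"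
    using card_square_le_monochromatic_pairs[of ?S "{1, 2, 3}" f] f
    by (simp add: three_colorings_def)
  ultimately have "3 * card ?R \<le> 2 * n\<^sup>2"
    by linarith
  then have "3 * real (card ?R) \<le> 2 * real (n\<^sup>2)"
    by (metis of_nat_le_iff of_nat_mult of_nat_numeral)
  then show "rb_coloring Cyclic 1 1 2 n f \<le> 2 / 3"
    using assms unfolding rb_coloring_def card_solutions_Cyclic by (simp add: divide_le_eq)
qed

text \<open>When 3 divides the modulus, the congruence survives reduction modulo 3, so x + y + z is
  divisible by 3 for wrap-around solutions too. Only solutions with y and z congruent modulo 3 can
  then be lost.\<close>

lemma rb_Cyclic_multiple_of_3_ge:
  assumes "t \<ge> 1"
  shows "2 / 3 \<le> rb Cyclic 1 1 2 (3 * t)"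
proof -
  let ?n = "3 * t"
  let ?f = "mod_3_coloring (ambient_set Cyclic ?n)"
  let ?T = "solutions Cyclic 1 1 2 ?n"
  let ?R = "rainbow_solutions Cyclic 1 1 2 ?n ?f"
  let ?M = "{(y, z) \<in> {0..<0 + ?n} \<times> {0..<0 + ?n}. y mod 3 = z mod (3::nat)}"
  have "3 dvd x + y + z" if "[x + y = 2 * z] (mod ?n)" for x y z
  proof -
    have "[x + y = 2 * z] (mod 3)"
      using that by (rule cong_dvd_modulus_nat) simp
    from cong_add[OF this cong_refl[of z]] show ?thesis
      by (simp add: cong_def dvd_eq_mod_eq_0)
  qed
  then have rainbow: "(x, y, z) \<in> ?R" if "(x, y, z) \<in> ?T" "y mod 3 \<noteq> z mod 3" for x y z
    using that distinct_mod_3[of x y z] unfolding rainbow_mod_3_coloring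
    by (simp add: solutions_def)
  have "snd ` ?T \<subseteq> snd ` ?R \<union> ?M"
  proof (rule image_subsetI)
    fix s assume s: "s \<in> ?T"
    obtain x y z where xyz: "s = (x, y, z)"
      by (cases s)
    show "snd s \<in> snd ` ?R \<union> ?M"
    proof (cases "y mod 3 = z mod 3")
      case True
      then show ?thesis
        using s by (simp add: xyz solutions_def)
    next
      case False
      then have "s \<in> ?R"
        using rainbow s by (simp only: xyz not_False_eq_True)
      then show ?thesis
        by blast
    qed
  qed
  moreover have fin: "finite ?R" "finite ?M"
    by (rule finite_rainbow_solutions, rule finite_subset[of _ "{0..<0 + ?n} \<times> {0..<0 + ?n}"]) auto
  ultimately have "card (snd ` ?T) \<le> card (snd ` ?R) + card ?M"
    by (meson card_Un_le card_mono finite_UnI finite_imageI le_trans)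
  also have "\<dots> \<le> card ?R + ?n * ((?n + 3 - 1) div 3)"
    by (intro add_mono card_image_le fin card_congruent_pairs_le) simp
  \<comment> \<open>No rounding loss occurs here, which makes the bound exact: at most 3t^2 of the
    9t^2 pairs are lost.\<close>
  also have "(?n + 3 - 1) div 3 = t"
    by simp
  also have "card (snd ` ?T) = ?n\<^sup>2"
    using bij_betw_solutions_Cyclic[of ?n]
    by (simp add: bij_betw_def card_cartesian_product power2_eq_square)
  finally have "?n\<^sup>2 \<le> card ?R + ?n * t" .
  then have "6 * t\<^sup>2 \<le> card ?R"
    by (simp add: power2_eq_square)
  then have "6 * (real t)\<^sup>2 \<le> card ?R"
    by (metis of_nat_le_iff of_nat_mult of_nat_numeral of_nat_power)
  then have "2 / 3 \<le> rb_coloring Cyclic 1 1 2 ?n ?f"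
    using assms unfolding rb_coloring_def card_solutions_Cyclic
    by (simp add: pos_le_divide_eq power_mult_distrib)
  also have "\<dots> \<le> rb Cyclic 1 1 2 ?n"
    using assms by (intro rb_coloring_le_rb ambient_mod_3_coloring_in_three_colorings) simp
  finally show ?thesis .
qed

section \<open>Passage to the limit inferior and assembly\<close>

lemma three_rainbow_uncommonI:
  assumes "\<And>n. n \<ge> N \<Longrightarrow> B \<le> rb X a b c n" "B > 2 / 9"
  shows "three_rainbow_uncommon X a b c"
proof -
  have "\<forall>\<^sub>F n in sequentially. ereal B \<le> ereal (rb X a b c n)"
    using assms(1) by (auto simp: eventually_sequentially)
  then have "ereal B \<le> liminf (\<lambda>n. ereal (rb X a b c n))"
    by (rule Liminf_bounded)
  with assms(2) show ?thesis
    unfolding three_rainbow_uncommon_def by (meson ereal_less(2) less_ereal.simps(1) less_le_trans)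
qed

theorem theorem1p1:
  "three_rainbow_uncommon Interval 1 1 2 \<and>
   three_rainbow_uncommon Cyclic 1 1 2 \<and>
   (\<exists>\<epsilon> :: nat \<Rightarrow> real. \<epsilon> \<longlonglongrightarrow> 0 \<and> (\<forall>n\<ge>3. 2 / 3 + \<epsilon> n \<le> rb Interval 1 1 2 n)) \<and>
   (\<exists>\<epsilon> :: nat \<Rightarrow> real. \<epsilon> \<longlonglongrightarrow> 0 \<and>
      (\<forall>n\<ge>3. \<not> 3 dvd n \<longrightarrow> 1 / 3 - \<epsilon> n \<le> rb Cyclic 1 1 2 n \<and> rb Cyclic 1 1 2 n \<le> 2 / 3)) \<and>
   (\<forall>n t :: nat. t \<ge> 1 \<and> n = 3 * t \<longrightarrow> rb Cyclic 1 1 2 n = 2 / 3)"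
proof (intro conjI)
  \<comment> \<open>The value 1/4 lies strictly between 2/9 and 1/3. The threshold 10 is where 1/3 -
    5/(6n) reaches 1/4 in the cyclic case below; it is ample here.\<close>
  have "1 / 4 \<le> rb Interval 1 1 2 n" if "n \<ge> 10" for n
  proof -
    have "1 / 4 \<le> 2 / 3 - 5 / (3 * real n)"
      using that by (simp add: field_simps)
    then show ?thesis
      using rb_Interval_ge[of n] that by linarith
  qed
  then show "three_rainbow_uncommon Interval 1 1 2"
    by (rule three_rainbow_uncommonI) auto
  have "1 / 4 \<le> rb Cyclic 1 1 2 n" if "n \<ge> 10" for n
  proof -
    have "1 / 4 \<le> 1 / 3 - 5 / (6 * real n)"
      using that by (simp add: field_simps)
    then show ?thesis
      using rb_Cyclic_ge[of n] that by linarith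
  qed
  then show "three_rainbow_uncommon Cyclic 1 1 2"
    by (rule three_rainbow_uncommonI) auto
  have lim: "(\<lambda>n. c * (1 / real n)) \<longlonglongrightarrow> 0" for c
    using tendsto_mult[OF tendsto_const lim_1_over_n[where 'a = real], of c] by simp
  \<comment> \<open>The error is added in this display, so its witness is negative; in the next one
    it is subtracted.\<close>
  show "\<exists>\<epsilon> :: nat \<Rightarrow> real. \<epsilon> \<longlonglongrightarrow> 0 \<and> (\<forall>n\<ge>3. 2 / 3 + \<epsilon> n \<le> rb Interval 1 1 2 n)"
    using lim[of "- 5 / 3"] rb_Interval_ge
    by (intro exI[of _ "\<lambda>n. - 5 / 3 * (1 / real n)"]) simp
  show "\<exists>\<epsilon> :: nat \<Rightarrow> real. \<epsilon> \<longlonglongrightarrow> 0 \<and>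
      (\<forall>n\<ge>3. \<not> 3 dvd n \<longrightarrow> 1 / 3 - \<epsilon> n \<le> rb Cyclic 1 1 2 n \<and> rb Cyclic 1 1 2 n \<le> 2 / 3)"
    using lim[of "5 / 6"] rb_Cyclic_ge rb_Cyclic_le
    by (intro exI[of _ "\<lambda>n. 5 / 6 * (1 / real n)"]) simp
  show "\<forall>n t :: nat. t \<ge> 1 \<and> n = 3 * t \<longrightarrow> rb Cyclic 1 1 2 n = 2 / 3"
    using rb_Cyclic_multiple_of_3_ge rb_Cyclic_le by (intro allI impI antisym) simp_all
qed

end
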